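(* Let $k$ and $m$ be positive integers and let $G = (V,E)$ be a $k$-edge-connected graph. Suppose that $|V| \ge 2m$ and $\delta(G) \ge k + m$. Then: (a) $G$ contains a matching $M$ with $|M| = m$ such that $G - M$ is $k$-edge-connected. (b) If, furthermore, $k \ge 2$ and $1 \le m \le k - 1$, then $G$ contains a matching $M$ with $|M| = m + 1$ such that $G - M$ is $k$-edge-connected.
   Context: All graphs are finite, undirected and simple. $\delta(G)$ is the minimum degree of $G$. A matching is a set of pairwise vertex-disjoint edges. $G - M$ denotes the graph with vertex set $V$ and edge set $E \setminus M$. A graph is $k$-edge-connected if it remains connected after deleting any set of fewer than $k$ edges. *)

theory Defs
  imports Main
begin

text \<open>
  A graph is given by its vertex set \<open>V\<close> and its edge set \<open>E\<close>; an edge is a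
  two-element set of vertices, which excludes loops and parallel edges.
\<close>

definition simple_graph :: "'a set \<Rightarrow> 'a set set \<Rightarrow> bool" where
  "simple_graph V E \<longleftrightarrow> finite V \<and> (\<forall>e\<in>E. e \<subseteq> V \<and> card e = 2)"

definition degree :: "'a set set \<Rightarrow> 'a \<Rightarrow> nat" where
  "degree E v = card {e \<in> E. v \<in> e}"

text \<open>Unspecified (a minimum over the empty set) if \<open>V\<close> is empty.\<close>

definition min_degree :: "'a set \<Rightarrow> 'a set set \<Rightarrow> nat" where
  "min_degree V E = Min (degree E ` V)"

definition matching :: "'a set set \<Rightarrow> 'a set set \<Rightarrow> bool" where
  "matching E M \<longleftrightarrow> M \<subseteq> E \<and> pairwise disjnt M"

definition adjacency :: "'a set set \<Rightarrow> ('a \<times> 'a) set" where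
  "adjacency E = {(u, v). {u, v} \<in> E}"

text \<open>The graph without vertices counts as disconnected, a single vertex as connected.\<close>

definition connected_graph :: "'a set \<Rightarrow> 'a set set \<Rightarrow> bool" where
  "connected_graph V E \<longleftrightarrow> V \<noteq> {} \<and> (\<forall>u\<in>V. \<forall>v\<in>V. (u, v) \<in> (adjacency E)\<^sup>*)"

text \<open>
  For a simple graph every \<open>F \<subseteq> E\<close> is finite, so \<open>card F\<close> is its true size.
\<close>

definition edge_connected :: "nat \<Rightarrow> 'a set \<Rightarrow> 'a set set \<Rightarrow> bool" where
  "edge_connected k V E \<longleftrightarrow> (\<forall>F\<subseteq>E. card F < k \<longrightarrow> connected_graph V (E - F))"

end

theory Submission
  imports Defs
begin

text \<open>
  The matching is built one edge at a time. Let \<open>M\<close> be a matching with \<open>G - M\<close> still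
  \<open>k\<close>-edge-connected and \<open>card M\<close> small compared with the degrees, let \<open>C\<close> be the set of vertices that
  \<open>M\<close> covers, and call a vertex outside \<open>C\<close> free. A proper nonempty vertex set \<open>X\<close> is tight if exactly
  \<open>k\<close> edges of \<open>G - M\<close> leave it. An edge between free vertices can be added to \<open>M\<close> as soon as it
  crosses no tight set.

  If \<open>X\<close> is a tight set, then \<open>X\<close> or its complement contains at most half of \<open>C\<close>, that is, at most
  \<open>card M\<close> covered vertices. Inside that side take an inclusion-minimal tight set \<open>Z\<close>. By
  submodularity of the cut function no edge inside \<open>Z\<close> crosses a tight set, so any edge between free
  vertices of \<open>Z\<close> may be added. If \<open>Z\<close> has no such edge, then its vertices have few neighbours
  inside \<open>Z\<close>, and the large degrees force more than \<open>k\<close> edges to leave \<open>Z\<close> (\<open>tight_cases\<close>). This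
  count fails in a single situation: \<open>M\<close> is one edge \<open>{a, b}\<close> whose two ends have degree \<open>k\<close> in
  \<open>G - M\<close>. There one takes a tight set that is minimal among those that contain \<open>a\<close>, do not contain
  \<open>b\<close> and differ from \<open>{a}\<close>, and argues in the same way (\<open>extendable_if_tight_ends\<close>).

  If there are no tight sets, every edge between free vertices will do. When the free vertices are
  independent, two of them, \<open>u\<close> and \<open>u'\<close>, have so many neighbours in \<open>C\<close> that some edge \<open>{a, b}\<close> of
  \<open>M\<close> can be exchanged for \<open>{u, a}\<close> and \<open>{u', b}\<close>. Only a cut with \<open>u, u'\<close> on one side and
  \<open>a, b\<close> on the other loses two edges, and counting leaving edges again shows that such a cut has at
  least \<open>k + 2\<close> edges (\<open>separating_cut_large\<close>).

  Part (b) is one more step of the same kind from a matching with \<open>m\<close> edges. Here the degree condition has no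
  slack left, which is where the exceptional situation above appears, and \<open>m < k\<close> provides the two free
  vertices, since a vertex of degree at least \<open>k + m\<close> forces more than \<open>2 * m + 1\<close> vertices.
\<close>

section \<open>Edge cuts\<close>

definition cut :: "'a set set \<Rightarrow> 'a set \<Rightarrow> 'a set set" where
  "cut E X = {e \<in> E. e \<inter> X \<noteq> {} \<and> \<not> e \<subseteq> X}"

lemma cut_subset: "cut E X \<subseteq> E"
  by (auto simp: cut_def)

lemma simple_graph_finite: "simple_graph V E \<Longrightarrow> finite E"
  unfolding simple_graph_def by (metis PowI finite_Pow_iff finite_subset subsetI)

lemma finite_cut: "finite E \<Longrightarrow> finite (cut E X)"
  using cut_subset finite_subset by metis

lemma simple_graph_mono: "simple_graph V E \<Longrightarrow> F \<subseteq> E \<Longrightarrow> simple_graph V F"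
  by (auto simp: simple_graph_def)

lemma cut_complement:
  assumes "simple_graph V E" "X \<subseteq> V"
  shows "cut E (V - X) = cut E X"
  using assms unfolding simple_graph_def cut_def by blast

text \<open>
  An edge in one of the two cuts on the left meets and leaves \<open>X\<close> or \<open>Y\<close>, and an edge in both of them
  crosses both \<open>X\<close> and \<open>Y\<close>.
\<close>
lemma cut_submodular:
  assumes "finite E"
  shows "card (cut E (X \<inter> Y)) + card (cut E (X \<union> Y)) \<le> card (cut E X) + card (cut E Y)"
proof -
  let ?c = "cut E"
  have fin: "finite (?c Z)" for Z
    using assms by (rule finite_cut)
  have "card (?c (X \<inter> Y) \<union> ?c (X \<union> Y)) \<le> card (?c X \<union> ?c Y)"
    by (rule card_mono) (use fin in \<open>auto simp: cut_def\<close>)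
  moreover have "card (?c (X \<inter> Y) \<inter> ?c (X \<union> Y)) \<le> card (?c X \<inter> ?c Y)"
    by (rule card_mono) (use fin in \<open>auto simp: cut_def\<close>)
  ultimately show ?thesis
    using card_Un_Int[OF fin fin, of "X \<inter> Y" "X \<union> Y"] card_Un_Int[OF fin fin, of X Y] by linarith
qed

text \<open>
  This replaces reachability by counting. A cut of fewer than \<open>k\<close> edges could be deleted; conversely, after
  deleting \<open>F\<close>, the vertices reachable from \<open>u\<close> form a set whose cut lies in \<open>F\<close>.
\<close>
lemma edge_connected_iff_cut:
  assumes "simple_graph V E" "V \<noteq> {}"
  shows "edge_connected k V E \<longleftrightarrow> (\<forall>X. X \<noteq> {} \<and> X \<subset> V \<longrightarrow> k \<le> card (cut E X))"
proof
  assume L: "edge_connected k V E"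
  show "\<forall>X. X \<noteq> {} \<and> X \<subset> V \<longrightarrow> k \<le> card (cut E X)"
  proof (intro allI impI, rule ccontr)
    fix X assume X: "X \<noteq> {} \<and> X \<subset> V" and "\<not> k \<le> card (cut E X)"
    then have conn: "connected_graph V (E - cut E X)"
      using L cut_subset unfolding edge_connected_def by (metis not_le_imp_less)
    obtain u v where uv: "u \<in> X" "v \<in> V" "v \<notin> X" "u \<in> V" using X by blast
    have "(u, v) \<in> (adjacency (E - cut E X))\<^sup>*"
      using conn uv unfolding connected_graph_def by blast
    then have "v \<in> X"
      using uv(1) by (induction) (auto simp: adjacency_def cut_def)
    then show False using uv by simp
  qed
next
  assume R: "\<forall>X. X \<noteq> {} \<and> X \<subset> V \<longrightarrow> k \<le> card (cut E X)"
  show "edge_connected k V E"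
    unfolding edge_connected_def
  proof (intro allI impI)
    fix F assume F: "F \<subseteq> E" "card F < k"
    have "(u, v) \<in> (adjacency (E - F))\<^sup>*" if u: "u \<in> V" and v: "v \<in> V" for u v
    proof -
      define X where "X = {x \<in> V. (u, x) \<in> (adjacency (E - F))\<^sup>*}"
      have "cut E X \<subseteq> F"
      proof
        fix e assume e: "e \<in> cut E X"
        then obtain x y where xy: "x \<in> e" "x \<in> X" "y \<in> e" "y \<notin> X" "e \<in> E"
          by (auto simp: cut_def)
        then have "card e = 2" "e \<subseteq> V" using assms by (auto simp: simple_graph_def)
        then have "e = {x, y}" "y \<in> V"
          using xy by (auto simp: card_2_iff)
        show "e \<in> F"
        proof (rule ccontr)
          assume "e \<notin> F"
          then have "(x, y) \<in> adjacency (E - F)"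
            using xy \<open>e = {x, y}\<close> by (auto simp: adjacency_def)
          then have "y \<in> X"
            using xy(2) \<open>y \<in> V\<close> by (auto simp: X_def)
          then show False using xy by simp
        qed
      qed
      then have "card (cut E X) < k"
        using F card_mono[of F] simple_graph_finite[OF assms(1)] finite_subset
        by (metis le_less_trans)
      then have "\<not> (X \<noteq> {} \<and> X \<subset> V)"
        using R by (meson linorder_not_le)
      moreover have "u \<in> X" "X \<subseteq> V"
        using u by (auto simp: X_def)
      ultimately have "X = V" by blast
      then show ?thesis using v by (auto simp: X_def)
    qed
    then show "connected_graph V (E - F)"
      using assms(2) by (auto simp: connected_graph_def)
  qed
qed

text \<open>
  All later contradictions count edges leaving a set at one or two vertices. The set \<open>S\<close> is a
  parameter because the neighbours of \<open>v\<close> inside \<open>X\<close> are sometimes known to be covered vertices.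
\<close>
lemma degree_le_inner_plus_leaving:
  assumes "simple_graph V E" "v \<in> X" "finite S"
    and S: "\<And>w. w \<in> X \<Longrightarrow> {v, w} \<in> E \<Longrightarrow> w \<in> S"
  shows "degree E v \<le> card S + card {e \<in> cut E X. v \<in> e}"
proof -
  have fin: "finite {e \<in> cut E X. v \<in> e}"
    using finite_cut[OF simple_graph_finite[OF assms(1)]] by simp
  have "{e \<in> E. v \<in> e} \<subseteq> (\<lambda>w. {v, w}) ` S \<union> {e \<in> cut E X. v \<in> e}"
  proof
    fix e assume e: "e \<in> {e \<in> E. v \<in> e}"
    then have "card e = 2" using assms by (auto simp: simple_graph_def)
    then obtain w where w: "e = {v, w}"
      using e by (auto simp: card_2_iff)
    show "e \<in> (\<lambda>w. {v, w}) ` S \<union> {e \<in> cut E X. v \<in> e}"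
      using S[of w] e w assms(2) by (cases "w \<in> X") (auto simp: cut_def)
  qed
  then have "degree E v \<le> card ((\<lambda>w. {v, w}) ` S \<union> {e \<in> cut E X. v \<in> e})"
    unfolding degree_def using fin assms(3) by (intro card_mono) auto
  also have "\<dots> \<le> card ((\<lambda>w. {v, w}) ` S) + card {e \<in> cut E X. v \<in> e}"
    by (rule card_Un_le)
  also have "\<dots> \<le> card S + card {e \<in> cut E X. v \<in> e}"
    using card_image_le[OF assms(3)] by simp
  finally show ?thesis .
qed

lemma degree_le_inner_neighbours_plus_leaving:
  assumes "simple_graph V E" "finite X" "v \<in> X"
  shows "degree E v + 1 \<le> card X + card {e \<in> cut E X. v \<in> e}"
proof -
  have "degree E v \<le> card (X - {v}) + card {e \<in> cut E X. v \<in> e}"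
  proof (rule degree_le_inner_plus_leaving[OF assms(1,3)])
    show "w \<in> X - {v}" if "w \<in> X" "{v, w} \<in> E" for w
      using that assms(1) by (auto simp: simple_graph_def)
  qed (use assms(2) in simp)
  moreover have "card (X - {v}) + 1 = card X"
    using card_Suc_Diff1[OF assms(2,3)] by simp
  ultimately show ?thesis by simp
qed

lemma degree_less_card:
  assumes "simple_graph V E" "v \<in> V"
  shows "degree E v < card V"
proof -
  have fin: "finite V" and "\<And>e. e \<in> E \<Longrightarrow> e \<subseteq> V"
    using assms(1) by (auto simp: simple_graph_def)
  then have "cut E V = {}"
    by (auto simp: cut_def)
  then show ?thesis
    using degree_le_inner_neighbours_plus_leaving[OF assms(1) fin assms(2)] by simp
qed

text \<open>
  An edge through both \<open>v\<close> and \<open>w\<close> lies inside \<open>X\<close>, so no edge of the cut is counted twice.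
\<close>
lemma leaving_edges_add:
  assumes "simple_graph V E" "v \<in> X" "w \<in> X" "v \<noteq> w"
  shows "card {e \<in> cut E X. v \<in> e} + card {e \<in> cut E X. w \<in> e} \<le> card (cut E X)"
proof -
  have fin: "finite (cut E X)"
    using finite_cut[OF simple_graph_finite[OF assms(1)]] .
  have "e \<subseteq> X" if "e \<in> E" "v \<in> e" "w \<in> e" for e
    using that assms by (auto simp: simple_graph_def card_2_iff)
  then have "{e \<in> cut E X. v \<in> e} \<inter> {e \<in> cut E X. w \<in> e} = {}"
    by (auto simp: cut_def)
  then have "card {e \<in> cut E X. v \<in> e} + card {e \<in> cut E X. w \<in> e}
      = card ({e \<in> cut E X. v \<in> e} \<union> {e \<in> cut E X. w \<in> e})"
    using fin by (simp add: card_Un_disjoint)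
  also have "\<dots> \<le> card (cut E X)"
    using fin by (intro card_mono) auto
  finally show ?thesis .
qed

lemma leaving_edges_le:
  assumes "simple_graph V E"
  shows "card {e \<in> cut E X. v \<in> e} \<le> card (cut E X)"
  using finite_cut[OF simple_graph_finite[OF assms]] by (intro card_mono) auto

section \<open>Matchings whose removal keeps the edge-connectivity\<close>

text \<open>
  The situation of one extension step; \<open>D\<close> is a lower bound for the degrees in the full graph. The two
  alternatives in \<open>slack\<close> are the steps of part (a), where \<open>card M < m\<close>, and the additional step of
  part (b), where \<open>card M = m\<close>.
\<close>
locale removable_matching =
  fixes V :: "'a set" and E M :: "'a set set" and k D :: nat
  assumes simple: "simple_graph V E"
    and matching: "matching E M"
    and k_pos: "1 \<le> k"
    and removable: "edge_connected k V (E - M)"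
    and degree_bound: "\<And>v. v \<in> V \<Longrightarrow> D \<le> degree E v"
    and slack: "k + card M < D \<or> k + card M \<le> D \<and> 2 \<le> k \<and> 1 \<le> card M"
begin

abbreviation covered :: "'a set" where "covered \<equiv> \<Union> M"

abbreviation cutsize :: "'a set \<Rightarrow> nat" where "cutsize X \<equiv> card (cut (E - M) X)"

abbreviation leaving :: "'a set \<Rightarrow> 'a \<Rightarrow> nat" where
  "leaving X v \<equiv> card {e \<in> cut (E - M) X. v \<in> e}"

definition tight :: "'a set \<Rightarrow> bool" where
  "tight X \<longleftrightarrow> X \<noteq> {} \<and> X \<subset> V \<and> cutsize X = k"

text \<open>
  Edges of \<open>M\<close> contain covered vertices, so it makes no difference whether \<open>E\<close> or \<open>E - M\<close> is used here.
\<close>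
definition free_independent :: "'a set \<Rightarrow> bool" where
  "free_independent X \<longleftrightarrow> (\<forall>e\<in>E. e \<subseteq> X \<longrightarrow> e \<inter> covered \<noteq> {})"

definition extendable :: bool where
  "extendable \<longleftrightarrow> (\<exists>N. matching E N \<and> card N = card M + 1 \<and> edge_connected k V (E - N))"

lemma slack_le: "k + card M \<le> D"
  using slack by auto

lemma V_nonempty: "V \<noteq> {}"
  using removable[unfolded edge_connected_def, rule_format, of "{}"] k_pos
  by (simp add: connected_graph_def)

lemma finite_V: "finite V"
  using simple by (simp add: simple_graph_def)

lemma finite_E: "finite E"
  using simple by (rule simple_graph_finite)

lemma finite_M: "finite M"
  using matching finite_E by (auto simp: matching_def intro: finite_subset)

lemma edgeD: "e \<in> E \<Longrightarrow> e \<subseteq> V" "e \<in> E \<Longrightarrow> card e = 2"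
  using simple by (auto simp: simple_graph_def)

lemma matching_edgeD: "e \<in> M \<Longrightarrow> e \<in> E"
  using matching by (auto simp: matching_def)

lemma covered_subset: "covered \<subseteq> V"
  using matching_edgeD edgeD by blast

lemma finite_covered: "finite covered"
  using covered_subset finite_V finite_subset by blast

lemma simple': "simple_graph V (E - M)"
  using simple by (rule simple_graph_mono) auto

lemma card_covered: "card covered = 2 * card M"
proof -
  have "card covered = (\<Sum>e\<in>M. card e)"
  proof (rule card_Union_disjoint)
    show "pairwise disjnt M" using matching by (simp add: matching_def)
    show "finite e" if "e \<in> M" for e
      using edgeD(1) matching_edgeD that finite_V finite_subset by metis
  qed
  also have "\<dots> = 2 * card M"
    using matching_edgeD edgeD by simp
  finally show ?thesis .
qed

lemma matching_unique: "e \<in> M \<Longrightarrow> f \<in> M \<Longrightarrow> x \<in> e \<Longrightarrow> x \<in> f \<Longrightarrow> e = f"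
  using matching unfolding matching_def pairwise_def disjnt_def by blast

lemma cutsize_ge: "X \<noteq> {} \<Longrightarrow> X \<subset> V \<Longrightarrow> k \<le> cutsize X"
  using removable edge_connected_iff_cut[OF simple' V_nonempty] by blast

lemma edge_connected_if_cuts:
  assumes "F \<subseteq> E" "\<And>X. X \<noteq> {} \<Longrightarrow> X \<subset> V \<Longrightarrow> k \<le> card (cut F X)"
  shows "edge_connected k V F"
  using edge_connected_iff_cut[OF simple_graph_mono[OF simple assms(1)] V_nonempty] assms(2) by simp

lemma cutsize_complement: "X \<subseteq> V \<Longrightarrow> cutsize (V - X) = cutsize X"
  using cut_complement[OF simple'] by simp

lemma finite_tight: "finite (Collect tight)"
  by (rule finite_subset[of _ "Pow V"]) (use finite_V in \<open>auto simp: tight_def\<close>)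

lemma tight_complement: "tight X \<Longrightarrow> tight (V - X)"
  unfolding tight_def using cutsize_complement[of X] by auto

lemma tight_Int:
  assumes "tight X" "tight Y" "X \<inter> Y \<noteq> {}" "X \<union> Y \<noteq> V"
  shows "tight (X \<inter> Y)"
proof -
  have "X \<inter> Y \<subset> V" "X \<union> Y \<subset> V" "X \<union> Y \<noteq> {}"
    using assms by (auto simp: tight_def)
  then have "k \<le> cutsize (X \<inter> Y)" "k \<le> cutsize (X \<union> Y)"
    using cutsize_ge[of "X \<inter> Y"] cutsize_ge[of "X \<union> Y"] assms(3) by simp_all
  moreover have "cutsize (X \<inter> Y) + cutsize (X \<union> Y) \<le> k + k"
    using cut_submodular[of "E - M" X Y] finite_E assms(1,2) by (simp add: tight_def)
  ultimately show ?thesis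
    using assms(3) \<open>X \<inter> Y \<subset> V\<close> by (simp add: tight_def)
qed

text \<open>
  A free vertex has kept its full degree, and in a set without edges between free vertices its neighbours are
  covered.
\<close>
lemma leaving_free:
  assumes "X \<subseteq> V" "free_independent X" "w \<in> X - covered"
  shows "D \<le> card (X \<inter> covered) + leaving X w"
proof -
  have "{e \<in> E - M. w \<in> e} = {e \<in> E. w \<in> e}"
    using assms(3) by auto
  then have "D \<le> degree (E - M) w"
    using degree_bound[of w] assms by (auto simp: degree_def)
  also have "\<dots> \<le> card (X \<inter> covered) + leaving X w"
  proof (rule degree_le_inner_plus_leaving[OF simple'])
    show "x \<in> X \<inter> covered" if "x \<in> X" "{w, x} \<in> E - M" for x
      using assms(2)[unfolded free_independent_def, rule_format, of "{w, x}"] that assms(3) by simp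
  qed (use assms finite_covered in auto)
  finally show ?thesis .
qed

lemma degree_remaining: "v \<in> V \<Longrightarrow> D \<le> degree (E - M) v + 1"
proof -
  assume v: "v \<in> V"
  have "card {e \<in> M. v \<in> e} \<le> 1"
    using finite_M matching_unique by (subst One_nat_def, subst card_le_Suc0_iff_eq) auto
  moreover have "{e \<in> E. v \<in> e} = {e \<in> E - M. v \<in> e} \<union> {e \<in> M. v \<in> e}"
    using matching_edgeD by auto
  then have "degree E v \<le> degree (E - M) v + card {e \<in> M. v \<in> e}"
    unfolding degree_def by (metis card_Un_le)
  ultimately show ?thesis
    using degree_bound[OF v] by linarith
qed

text \<open>
  The possible loss of one edge of \<open>M\<close> at \<open>v\<close> is compensated by \<open>v\<close> not being its own neighbour.
\<close>
lemma leaving_any: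
  assumes "X \<subseteq> V" "v \<in> X"
  shows "D \<le> card X + leaving X v"
proof -
  have fin: "finite X" using assms finite_V finite_subset by blast
  show ?thesis
    using degree_le_inner_neighbours_plus_leaving[OF simple' fin assms(2)]
      degree_remaining[of v] assms by auto
qed

lemma card_split: "X \<subseteq> V \<Longrightarrow> card X = card (X \<inter> covered) + card (X - covered)"
  using card_Int_Diff[of X covered] finite_subset[OF _ finite_V] by auto

lemma card_covered_split:
  assumes "X \<subseteq> V"
  shows "card (X \<inter> covered) + card ((V - X) \<inter> covered) = 2 * card M"
proof -
  have "(V - X) \<inter> covered = covered - X"
    using covered_subset by auto
  then show ?thesis
    using card_Int_Diff[OF finite_covered, of X] card_covered by (simp add: Int_commute)
qed

lemma leaving_two_le:
  "v \<in> X \<Longrightarrow> w \<in> X \<Longrightarrow> v \<noteq> w \<Longrightarrow> leaving X v + leaving X w \<le> cutsize X"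
  using leaving_edges_add[OF simple'] .

lemma leaving_le: "leaving X v \<le> cutsize X"
  using leaving_edges_le[OF simple'] .

lemma extendable_by_edge:
  assumes e: "e \<in> E" "e \<inter> covered = {}"
    and noncritical: "\<And>Y. tight Y \<Longrightarrow> e \<notin> cut (E - M) Y"
  shows extendable
proof -
  have "e \<noteq> {}" using edgeD[OF e(1)] by auto
  then have "e \<notin> M" using e by auto
  have "k \<le> card (cut (E - insert e M) X)" if X: "X \<noteq> {}" "X \<subset> V" for X
  proof -
    have "cut (E - insert e M) X = cut (E - M) X - {e}"
      by (auto simp: cut_def)
    moreover have "k + 1 \<le> cutsize X" if "e \<in> cut (E - M) X"
      using noncritical[of X] that cutsize_ge[OF X] X unfolding tight_def by fastforce
    ultimately show ?thesis
      using cutsize_ge[OF X] finite_cut[of "E - M" X] finite_E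
      by (cases "e \<in> cut (E - M) X") auto
  qed
  then have "edge_connected k V (E - insert e M)"
    by (intro edge_connected_if_cuts) auto
  moreover have "matching E (insert e M)"
    using matching e unfolding matching_def pairwise_def disjnt_def by blast
  moreover have "card (insert e M) = card M + 1"
    using finite_M \<open>e \<notin> M\<close> by simp
  ultimately show ?thesis
    unfolding extendable_def by blast
qed

text \<open>
  If a tight set \<open>Y\<close> split an edge inside \<open>X\<close>, then \<open>X \<inter> Y\<close>, or \<open>V - Y\<close> in case \<open>X\<close> and \<open>Y\<close>
  cover \<open>V\<close>, would be a smaller tight set.
\<close>
lemma minimal_tight_inner_edge:
  assumes X: "tight X" and min: "\<And>Z. tight Z \<Longrightarrow> \<not> Z \<subset> X"
    and e: "e \<subseteq> X" and Y: "tight Y"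
  shows "e \<notin> cut (E - M) Y"
proof
  assume cutY: "e \<in> cut (E - M) Y"
  then have ne: "e \<inter> Y \<noteq> {}" "\<not> e \<subseteq> Y"
    by (auto simp: cut_def)
  show False
  proof (cases "X \<union> Y = V")
    case True
    then have "V - Y \<subset> X" using ne e by auto
    then show False using min tight_complement[OF Y] by blast
  next
    case False
    then have "tight (X \<inter> Y)" using tight_Int[OF X Y] ne e by blast
    moreover have "X \<inter> Y \<subset> X" using ne e by blast
    ultimately show False using min by blast
  qed
qed

text \<open>
  In a minimal tight set \<open>Z\<close> inside \<open>X\<close> every edge between free vertices can be added to \<open>M\<close>. If there
  is none, each free vertex of \<open>Z\<close> has at least \<open>D - card M\<close> edges leaving \<open>Z\<close>, and so has each vertex of
  \<open>Z\<close> in case all of them are covered. This exhausts the \<open>k\<close> edges of the cut at a single vertex, and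
  only a one-vertex set \<open>Z\<close> survives.
\<close>
lemma tight_cases:
  assumes X: "tight X" and few: "card (X \<inter> covered) \<le> card M"
  shows "extendable \<or> card M = 1 \<and> D = k + 1 \<and> 2 \<le> k \<and> (\<exists>v\<in>X \<inter> covered. tight {v})"
proof (rule disjCI)
  assume exc: "\<not> (card M = 1 \<and> D = k + 1 \<and> 2 \<le> k \<and> (\<exists>v\<in>X \<inter> covered. tight {v}))"
  have fin: "finite {Z. Z \<subseteq> X \<and> tight Z}"
    using finite_tight by (rule finite_subset[rotated]) auto
  have "{Z. Z \<subseteq> X \<and> tight Z} \<noteq> {}"
    using X by blast
  from finite_has_minimal[OF fin this] obtain Z where Z: "Z \<subseteq> X" "tight Z" and "\<And>Z'. Z' \<subseteq> X \<Longrightarrow> tight Z' \<Longrightarrow> Z' \<subseteq> Z \<Longrightarrow> Z = Z'"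
    by auto
  then have min: "\<not> Z' \<subset> Z" if "tight Z'" for Z'
    using that by (metis order.strict_iff_order order_trans)
  have ZV: "Z \<subseteq> V" "Z \<noteq> {}" "cutsize Z = k" using Z by (auto simp: tight_def)
  have finZ: "finite Z" using ZV finite_V finite_subset by blast
  have "card (Z \<inter> covered) \<le> card (X \<inter> covered)"
    using Z finite_covered by (intro card_mono) auto
  then have few': "card (Z \<inter> covered) \<le> card M" using few by simp
  have "\<not> free_independent Z"
  proof
    assume ind: "free_independent Z"
    have any: "D \<le> card Z + leaving Z v" if "v \<in> Z" for v
      using leaving_any[OF ZV(1) that] .
    show False
    proof (cases "Z \<subseteq> covered")
      case True
      then have cZ: "card Z \<le> card M" using few' by (simp add: inf.absorb1)
      obtain v where v: "v \<in> Z" using ZV by blast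
      have "Z = {v}"
      proof (rule ccontr)
        assume "Z \<noteq> {v}"
        then obtain v' where "v' \<in> Z" "v' \<noteq> v" using v by blast
        then show False
          using any[OF v] any[of v'] leaving_two_le[of v Z v'] v ZV(3) cZ slack_le k_pos by simp
      qed
      moreover have "1 \<le> card M" using cZ \<open>Z = {v}\<close> by simp
      moreover have "D \<le> k + 1" using any[OF v] leaving_le[of Z v] ZV(3) \<open>Z = {v}\<close> by simp
      ultimately have "card M = 1 \<and> D = k + 1 \<and> 2 \<le> k \<and> tight {v} \<and> v \<in> X \<inter> covered"
        using slack Z True v by auto
      then show False using exc by blast
    next
      case False
      then obtain w where w: "w \<in> Z - covered" by blast
      have free: "D \<le> card (Z \<inter> covered) + leaving Z w'" if "w' \<in> Z - covered" for w'
        using leaving_free[OF ZV(1) ind that] .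
      \<comment> \<open>One free vertex already uses up the whole cut, so equality holds in every estimate,
        and a covered vertex of \<open>Z\<close> would have no leaving edge, against its degree.\<close>
      have eq: "card (Z \<inter> covered) = card M" "k \<le> leaving Z w" and k2: "2 \<le> k" "1 \<le> card M" "D = k + card M"
        using free[OF w] leaving_le[of Z w] ZV(3) few' slack by auto
      have one: "Z - covered = {w}"
      proof (rule ccontr)
        assume "Z - covered \<noteq> {w}"
        then obtain w' where "w' \<in> Z - covered" "w' \<noteq> w" using w by blast
        then show False
          using eq free[of w'] leaving_two_le[of w Z w'] w ZV(3) k2 by auto
      qed
      have "Z \<inter> covered \<noteq> {}" using eq k2 by auto
      then obtain v where v: "v \<in> Z" "v \<in> covered" by blast
      have "D \<le> card M + 1 + leaving Z v"
        using any[OF v(1)] card_split[OF ZV(1)] one eq by simp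
      moreover have "leaving Z v + leaving Z w \<le> k"
        using leaving_two_le[of v Z w] v w ZV(3) by auto
      ultimately show False using eq k2 by simp
    qed
  qed
  then obtain e where e: "e \<in> E" "e \<subseteq> Z" "e \<inter> covered = {}"
    by (auto simp: free_independent_def)
  then show extendable
    using extendable_by_edge[of e] minimal_tight_inner_edge[OF Z(2) min e(2)] by blast
qed

text \<open>
  The tight sets \<open>{a}\<close> and \<open>{b}\<close> hide the larger ones from \<open>tight_cases\<close>, so minimality is taken among
  the tight sets \<open>X \<noteq> {a}\<close> that separate \<open>a\<close> from \<open>b\<close>; the complement of \<open>{b}\<close> is one of them. All
  vertices of \<open>X - {a}\<close> are free. If they are independent, each has at least \<open>k\<close> edges leaving \<open>X\<close>, which
  leaves room for one vertex \<open>x\<close>, and then \<open>a\<close> has a leaving edge too many.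
\<close>
lemma extendable_if_tight_ends:
  assumes M: "covered = {a, b}" "a \<noteq> b" and ta: "tight {a}" and tb: "tight {b}"
    and k2: "2 \<le> k" and D: "D = k + 1" and M1: "card M = 1"
  shows extendable
proof (rule ccontr)
  assume not_ext: "\<not> extendable"
  define P where "P X \<longleftrightarrow> tight X \<and> a \<in> X \<and> b \<notin> X \<and> X \<noteq> {a}" for X
  have ab: "a \<in> V" "b \<in> V" using M covered_subset by auto
  have "P (V - {b})"
  proof -
    have "V - {b} \<noteq> {a}"
    proof
      assume "V - {b} = {a}"
      then have "V = {a, b}" using ab by auto
      then have "card V = 2" using M by simp
      moreover have "D < card V"
        using degree_bound[OF ab(1)] degree_less_card[OF simple ab(1)] by simp
      ultimately show False using D k2 by simp
    qed
    then show ?thesis using tight_complement[OF tb] ab M by (auto simp: P_def)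
  qed
  then have ne: "{X. P X} \<noteq> {}"
    by blast
  have "finite {X. P X}"
    using finite_tight by (rule finite_subset[rotated]) (auto simp: P_def)
  from finite_has_minimal[OF this ne] obtain X where X: "P X" and min: "\<And>Z. P Z \<Longrightarrow> Z \<subseteq> X \<Longrightarrow> X = Z"
    by auto
  have XD: "tight X" "a \<in> X" "b \<notin> X" "X \<noteq> {a}" using X by (auto simp: P_def)
  have inner: "e \<notin> cut (E - M) Y" if e: "e \<subseteq> X - {a}" and Y: "tight Y" and aY: "a \<in> Y" for e Y
  proof
    assume "e \<in> cut (E - M) Y"
    then have ne: "e \<inter> Y \<noteq> {}" "\<not> e \<subseteq> Y" by (auto simp: cut_def)
    show False
    proof (cases "X \<union> Y = V")
      case True
      \<comment> \<open>A tight set without covered vertices always allows an extension.\<close>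
      then have "(V - Y) \<inter> covered = {}" using M XD aY by auto
      then show False using tight_cases[OF tight_complement[OF Y]] not_ext by auto
    next
      case False
      then have "tight (X \<inter> Y)" using tight_Int[OF XD(1) Y] XD aY by blast
      then have "P (X \<inter> Y)" using XD aY ne e by (auto simp: P_def)
      then show False using min[of "X \<inter> Y"] ne e by auto
    qed
  qed
  have ind: "free_independent X"
    unfolding free_independent_def
  proof (intro ballI impI notI)
    fix e assume e: "e \<in> E" "e \<subseteq> X" "e \<inter> covered = {}"
    then have eX: "e \<subseteq> X - {a}" using M by auto
    have "e \<notin> cut (E - M) Y" if Y: "tight Y" for Y
    proof (cases "a \<in> Y")
      case True then show ?thesis using inner[OF eX Y] by simp
    next
      case False
      then have "e \<notin> cut (E - M) (V - Y)"
        using inner[OF eX tight_complement[OF Y]] ab by simp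
      then show ?thesis using cut_complement[OF simple', of Y] Y by (auto simp: tight_def)
    qed
    then show False using extendable_by_edge[OF e(1,3)] not_ext by blast
  qed
  have XV: "X \<subseteq> V" "cutsize X = k" using XD by (auto simp: tight_def)
  have Xc: "X \<inter> covered = {a}" using XD M by auto
  obtain x where x: "x \<in> X" "x \<noteq> a" using XD by blast
  have free: "k \<le> leaving X w" if "w \<in> X" "w \<noteq> a" for w
    using leaving_free[OF XV(1) ind, of w] that Xc D by auto
  have "X = {a, x}"
  proof (rule ccontr)
    assume "X \<noteq> {a, x}"
    then obtain y where "y \<in> X" "y \<noteq> a" "y \<noteq> x" using x XD by blast
    then show False using free[of x] free[of y] leaving_two_le[of x X y] x XV k2 by simp
  qed
  then have "D \<le> 2 + leaving X a"
    using leaving_any[OF XV(1) XD(2)] x by simp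
  then show False
    using free[of x] leaving_two_le[of x X a] x XV XD D k2 by simp
qed

text \<open>
  By \<open>card_covered_split\<close>, a tight set or its complement has at most \<open>card M\<close> covered vertices. In the
  exceptional case of \<open>tight_cases\<close> one of the only two covered vertices lies in this side, so the other
  side has at most one as well, and both ends of the single matching edge turn out to be tight.
\<close>
lemma extendable_if_tight:
  assumes X: "tight X"
  shows extendable
proof (rule ccontr)
  assume not_ext: "\<not> extendable"
  have *: extendable if X: "tight X" and few: "card (X \<inter> covered) \<le> card M" for X
  proof (rule ccontr)
    assume not_ext: "\<not> extendable"
    obtain a where a: "card M = 1" "D = k + 1" "2 \<le> k" "a \<in> X \<inter> covered" "tight {a}"
      using tight_cases[OF X few] not_ext by blast
    have XV: "X \<subseteq> V" using X by (auto simp: tight_def)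
    have "1 \<le> card (X \<inter> covered)"
      using a(4) finite_covered by (metis One_nat_def Suc_leI card_gt_0_iff empty_iff finite_Int)
    then have "card ((V - X) \<inter> covered) \<le> card M"
      using card_covered_split[OF XV] a(1) by simp
    then obtain b where b: "b \<in> (V - X) \<inter> covered" "tight {b}"
      using tight_cases[OF tight_complement[OF X]] not_ext by blast
    have "a \<noteq> b" using a b by auto
    then have "covered = {a, b}"
      using a b card_covered finite_covered card_seteq[of covered "{a, b}"] by simp
    then show False
      using extendable_if_tight_ends[OF _ \<open>a \<noteq> b\<close> a(5) b(2) a(3,2,1)] not_ext by blast
  qed
  have XV: "X \<subseteq> V" using X by (auto simp: tight_def)
  show False
    using *[OF X] *[OF tight_complement[OF X]] card_covered_split[OF XV] not_ext by linarith
qed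

text \<open>
  If \<open>X\<close> contains at most \<open>card M\<close> covered vertices, then \<open>u\<close> and \<open>u'\<close> each have \<open>D - card M\<close>
  edges leaving \<open>X\<close>, and twice this number is at least \<open>k + 2\<close> under either alternative of \<open>slack\<close>. Otherwise
  the complement has fewer than \<open>card M\<close> covered vertices, so that a free vertex there has at least \<open>k + 1\<close>
  leaving edges. Two vertices suffice again: \<open>a\<close> and \<open>b\<close>, \<open>a\<close> and the only free vertex, or two free
  vertices.
\<close>
lemma separating_cut_large:
  assumes ind: "free_independent V"
    and u: "u \<in> V - covered" "u' \<in> V - covered" "u \<noteq> u'"
    and ab: "{a, b} \<in> M" "a \<noteq> b"
    and X: "X \<subseteq> V" "u \<in> X" "u' \<in> X" "a \<notin> X" "b \<notin> X"
  shows "k + 2 \<le> cutsize X"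
proof -
  have indX: "free_independent Z" if "Z \<subseteq> V" for Z
    using ind that by (auto simp: free_independent_def)
  show ?thesis
  proof (cases "card (X \<inter> covered) \<le> card M")
    case True
    then show ?thesis
      using leaving_free[OF X(1) indX[OF X(1)], of u] leaving_free[OF X(1) indX[OF X(1)], of u']
        leaving_two_le[of u X u'] u X slack k_pos by auto
  next
    case False
    define Z where "Z = V - X"
    have Z: "Z \<subseteq> V" "a \<in> Z" "b \<in> Z" "a \<in> covered" "b \<in> covered"
      using X ab covered_subset by (auto simp: Z_def)
    have few: "card (Z \<inter> covered) + 1 \<le> card M"
      using card_covered_split[OF X(1)] False by (simp add: Z_def)
    have free: "k + 1 \<le> leaving Z w" if "w \<in> Z - covered" for w
      using leaving_free[OF Z(1) indX[OF Z(1)] that] few slack_le by simp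
    have any: "D \<le> card (Z \<inter> covered) + card (Z - covered) + leaving Z v" if "v \<in> Z" for v
      using leaving_any[OF Z(1) that] card_split[OF Z(1)] by simp
    have "k + 2 \<le> cutsize Z"
    proof (cases "Z \<subseteq> covered")
      case True
      then have "card (Z - covered) = 0" by (metis Diff_eq_empty_iff card.empty)
      then have "k + 1 \<le> leaving Z a" "k + 1 \<le> leaving Z b"
        using any[OF Z(2)] any[OF Z(3)] few slack_le by simp_all
      then show ?thesis using leaving_two_le[of a Z b] Z ab by simp
    next
      case False
      then obtain w where w: "w \<in> Z - covered" by blast
      show ?thesis
      proof (cases "Z - covered = {w}")
        case True
        then have "k \<le> leaving Z a"
          using any[OF Z(2)] few slack_le by simp
        moreover have "a \<noteq> w" using Z w by blast
        ultimately show ?thesis using free[OF w] leaving_two_le[of a Z w] Z w k_pos by simp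
      next
        case False
        then obtain w' where "w' \<in> Z - covered" "w' \<noteq> w" using w by blast
        then show ?thesis using free[OF w] free[of w'] leaving_two_le[of w Z w'] w k_pos by auto
      qed
    qed
    then show ?thesis using cutsize_complement[OF X(1)] by (simp add: Z_def)
  qed
qed

text \<open>
  Double counting: \<open>u\<close> and \<open>u'\<close> together send at least \<open>2 * D > 2 * card M\<close> edges to the covered
  vertices, so at least three go to one matching edge; then one end of it is adjacent to \<open>u\<close> and the other
  to \<open>u'\<close>.
\<close>
lemma augmenting_edge:
  assumes ind: "free_independent V"
    and u: "u \<in> V - covered" "u' \<in> V - covered"
  obtains a b where "{a, b} \<in> M" "a \<noteq> b" "{u, a} \<in> E" "{u', b} \<in> E"
proof (rule ccontr)
  assume "\<not> thesis"
  then have none: "\<not> ({a, b} \<in> M \<and> a \<noteq> b \<and> {u, a} \<in> E \<and> {u', b} \<in> E)" for a b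
    using that by blast
  define N where "N w = {x. {w, x} \<in> E}" for w
  have sum: "D \<le> (\<Sum>e\<in>M. card (e \<inter> N w))" if w: "w \<in> V - covered" for w
  proof -
    have sub: "{e \<in> E. w \<in> e} \<subseteq> (\<lambda>x. {w, x}) ` (\<Union>e\<in>M. e \<inter> N w)"
    proof
      fix e assume e: "e \<in> {e \<in> E. w \<in> e}"
      then have "card e = 2" "e \<subseteq> V" using edgeD by auto
      then obtain x where x: "e = {w, x}" using e by (auto simp: card_2_iff)
      then have "x \<in> covered"
        using ind[unfolded free_independent_def, rule_format, of e] e w \<open>e \<subseteq> V\<close> by simp
      then show "e \<in> (\<lambda>x. {w, x}) ` (\<Union>e\<in>M. e \<inter> N w)"
        using x e by (auto simp: N_def)
    qed
    have fin: "finite (\<Union>e\<in>M. e \<inter> N w)"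
      using finite_covered by (rule finite_subset[rotated]) auto
    have "D \<le> card {e \<in> E. w \<in> e}"
      using degree_bound w by (simp add: degree_def)
    also have "\<dots> \<le> card ((\<lambda>x. {w, x}) ` (\<Union>e\<in>M. e \<inter> N w))"
      using sub fin by (intro card_mono) auto
    also have "\<dots> \<le> card (\<Union>e\<in>M. e \<inter> N w)"
      using fin by (rule card_image_le)
    also have "\<dots> \<le> (\<Sum>e\<in>M. card (e \<inter> N w))"
      using finite_M by (rule card_UN_le)
    finally show ?thesis .
  qed
  have two: "card (e \<inter> N u) + card (e \<inter> N u') \<le> 2" if e: "e \<in> M" for e
  proof -
    obtain a b where ab: "e = {a, b}" "a \<noteq> b"
      using edgeD(2)[OF matching_edgeD[OF e]] by (auto simp: card_2_iff)
    have "\<not> (a \<in> N u \<and> b \<in> N u')" "\<not> (b \<in> N u \<and> a \<in> N u')"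
      using none[of a b] none[of b a] e ab by (auto simp: N_def insert_commute)
    then show ?thesis
      unfolding ab(1) using ab(2)
      by (cases "a \<in> N u"; cases "b \<in> N u"; cases "a \<in> N u'"; cases "b \<in> N u'") auto
  qed
  have "D + D \<le> (\<Sum>e\<in>M. card (e \<inter> N u)) + (\<Sum>e\<in>M. card (e \<inter> N u'))"
    using sum[OF u(1)] sum[OF u(2)] by simp
  also have "\<dots> = (\<Sum>e\<in>M. card (e \<inter> N u) + card (e \<inter> N u'))"
    by (simp add: sum.distrib)
  also have "\<dots> \<le> (\<Sum>e\<in>M. 2)"
    using two by (rule sum_mono)
  finally show False
    using slack_le k_pos by simp
qed

text \<open>
  This is an augmenting path of length three. Every cut has at least \<open>k + 1\<close> edges here, so a cut can drop
  below \<open>k\<close> only if it loses both new matching edges and does not regain \<open>{a, b}\<close>; then it separates \<open>u\<close>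
  and \<open>u'\<close> from \<open>a\<close> and \<open>b\<close>.
\<close>
lemma extendable_by_swap:
  assumes none: "\<And>X. \<not> tight X" and ind: "free_independent V"
    and u: "u \<in> V - covered" "u' \<in> V - covered" "u \<noteq> u'"
  shows extendable
proof -
  obtain a b where ab: "{a, b} \<in> M" "a \<noteq> b" "{u, a} \<in> E" "{u', b} \<in> E"
    using augmenting_edge[OF ind u(1,2)] .
  have abV: "a \<in> covered" "b \<in> covered" using ab by auto
  define M0 where "M0 = M - {{a, b}}"
  define N where "N = insert {u, a} (insert {u', b} M0)"
  have neq: "u \<noteq> a" "u \<noteq> b" "u' \<noteq> a" "u' \<noteq> b" using u abV by auto
  have M0: "f \<in> M" "a \<notin> f" "b \<notin> f" "u \<notin> f" "u' \<notin> f" if "f \<in> M0" for f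
    using that matching_unique[OF ab(1), of f] u by (auto simp: M0_def)
  have "pairwise disjnt M0"
    using matching unfolding M0_def matching_def by (meson Diff_subset pairwise_subset)
  moreover have "disjnt {u, a} f \<and> disjnt {u', b} f" if "f \<in> M0" for f
    using M0[OF that] by (simp add: disjnt_def)
  moreover have "disjnt {u, a} {u', b}"
    using neq u ab by (auto simp: disjnt_def)
  ultimately have "pairwise disjnt N"
    unfolding N_def pairwise_insert by (auto simp: disjnt_sym)
  moreover have "N \<subseteq> E"
    using ab matching_edgeD by (auto simp: N_def M0_def)
  ultimately have "matching E N" by (simp add: matching_def)
  moreover have "card N = card M + 1"
  proof -
    have "{u', b} \<notin> M0" "{u, a} \<notin> M0" "{u, a} \<noteq> {u', b}"
      using M0(2,3) neq u(3) by (auto simp: doubleton_eq_iff)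
    moreover have "card M0 + 1 = card M"
      using finite_M ab(1) card_Suc_Diff1[of M "{a, b}"] by (simp add: M0_def)
    ultimately show ?thesis
      using finite_M by (simp add: N_def M0_def)
  qed
  moreover have "edge_connected k V (E - N)"
  proof -
    have "k \<le> card (cut (E - N) X)" if X: "X \<noteq> {}" "X \<subset> V" for X
    proof -
      let ?C = "cut (E - M) X" and ?e = "{u, a}" and ?f = "{u', b}"
      have fin: "finite ?C" "finite (cut (E - N) X)" using finite_E by (auto intro: finite_cut)
      have d1: "k + 1 \<le> cutsize X"
        using cutsize_ge[OF X] none[of X] X by (auto simp: tight_def)
      have sub: "?C - {?e, ?f} \<subseteq> cut (E - N) X"
        by (auto simp: cut_def N_def M0_def)
      have diff: "cutsize X \<le> card (?C - S) + card S" if "finite S" for S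
        using diff_card_le_card_Diff[OF that, of ?C] by simp
      consider (e) "?e \<notin> ?C" | (f) "?f \<notin> ?C" | (ab) "{a, b} \<in> cut E X"
        | (far) "?e \<in> ?C" "?f \<in> ?C" "{a, b} \<notin> cut E X" by blast
      then show ?thesis
      proof cases
        case e
        then have "?C - {?e, ?f} = ?C - {?f}" by auto
        then show ?thesis using card_mono[OF fin(2) sub] diff[of "{?f}"] d1 by simp
      next
        case f
        then have "?C - {?e, ?f} = ?C - {?e}" by auto
        then show ?thesis using card_mono[OF fin(2) sub] diff[of "{?e}"] d1 by simp
      next
        case ab': ab
        have "{a, b} \<notin> N" using neq ab by (auto simp: N_def M0_def doubleton_eq_iff)
        then have "insert {a, b} (?C - {?e, ?f}) \<subseteq> cut (E - N) X"
          using sub ab' by (auto simp: cut_def)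
        then have "card (insert {a, b} (?C - {?e, ?f})) \<le> card (cut (E - N) X)"
          by (rule card_mono[OF fin(2)])
        moreover have "{a, b} \<notin> ?C" using ab(1) by (auto simp: cut_def)
        ultimately have "card (?C - {?e, ?f}) + 1 \<le> card (cut (E - N) X)"
          using fin by simp
        moreover have "card {?e, ?f} \<le> 2" by (simp add: card_insert_if)
        ultimately show ?thesis using diff[of "{?e, ?f}"] d1 by simp
      next
        case far
        have side: "a \<in> X \<longleftrightarrow> b \<in> X" "u \<in> X \<longleftrightarrow> a \<notin> X" "u' \<in> X \<longleftrightarrow> b \<notin> X"
          using far ab(1) matching_edgeD by (auto simp: cut_def)
        have XV: "X \<subseteq> V" using X by auto
        have "k + 2 \<le> cutsize X"
        proof (cases "a \<in> X")
          case True
          then have "k + 2 \<le> cutsize (V - X)"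
            using side u separating_cut_large[OF ind u ab(1,2), of "V - X"] by auto
          then show ?thesis using cutsize_complement[OF XV] by simp
        next
          case False
          then show ?thesis
            using side separating_cut_large[OF ind u ab(1,2) XV] by auto
        qed
        moreover have "card {?e, ?f} \<le> 2" by (simp add: card_insert_if)
        ultimately show ?thesis
          using card_mono[OF fin(2) sub] diff[of "{?e, ?f}"] by simp
      qed
    qed
    then show ?thesis
      by (intro edge_connected_if_cuts) auto
  qed
  ultimately show ?thesis unfolding extendable_def by blast
qed

theorem extend_matching:
  assumes "2 * card M + 2 \<le> card V"
  shows "\<exists>N. matching E N \<and> card N = card M + 1 \<and> edge_connected k V (E - N)"
proof -
  consider (tight) X where "tight X" | (free) "\<And>X. \<not> tight X" "\<not> free_independent V"
    | (swap) "\<And>X. \<not> tight X" "free_independent V" by blast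
  then have extendable
  proof cases
    case tight
    then show ?thesis by (rule extendable_if_tight)
  next
    case free
    then obtain e where "e \<in> E" "e \<inter> covered = {}" by (auto simp: free_independent_def)
    then show ?thesis using free(1) extendable_by_edge by blast
  next
    case swap
    have "2 \<le> card (V - covered)"
      using assms card_covered card_Diff_subset[OF finite_covered covered_subset] by simp
    then obtain T where "T \<subseteq> V - covered" "card T = 2"
      using obtain_subset_with_card_n by metis
    then obtain u u' where "u \<in> V - covered" "u' \<in> V - covered" "u \<noteq> u'"
      by (auto simp: card_2_iff)
    then show ?thesis using extendable_by_swap[OF swap] by blast
  qed
  then show ?thesis by (simp add: extendable_def)
qed

end

section \<open>Removing a matching of prescribed size\<close>

lemma removable_matching_exists:
  assumes k: "1 \<le> k" and simple: "simple_graph V E" and ec: "edge_connected k V E"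
    and V: "2 * m \<le> card V" and deg: "\<And>v. v \<in> V \<Longrightarrow> k + m \<le> degree E v" and "j \<le> m"
  shows "\<exists>M. matching E M \<and> card M = j \<and> edge_connected k V (E - M)"
  using \<open>j \<le> m\<close>
proof (induction j)
  case 0
  have "matching E {}" by (simp add: matching_def)
  then show ?case using ec by (metis Diff_empty card.empty)
next
  case (Suc j)
  then obtain M where M: "matching E M" "card M = j" "edge_connected k V (E - M)" by auto
  interpret removable_matching V E M k "k + m"
    using k simple deg M Suc.prems by unfold_locales auto
  show ?case using extend_matching V M Suc.prems by simp
qed

theorem theorem1p5:
  fixes V :: "'a set" and E :: "'a set set" and k m :: nat
  assumes "k \<ge> 1" and "m \<ge> 1"
    and "simple_graph V E"
    and "edge_connected k V E"
    and "card V \<ge> 2 * m"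
    and "min_degree V E \<ge> k + m"
  shows "(\<exists>M. matching E M \<and> card M = m \<and> edge_connected k V (E - M)) \<and>
    (k \<ge> 2 \<and> 1 \<le> m \<and> m \<le> k - 1 \<longrightarrow>
      (\<exists>M. matching E M \<and> card M = m + 1 \<and> edge_connected k V (E - M)))"
proof -
  have fin: "finite V" using assms(3) by (simp add: simple_graph_def)
  have deg: "k + m \<le> degree E v" if "v \<in> V" for v
    using assms(6) fin that unfolding min_degree_def
    by (meson Min_le finite_imageI imageI order_trans)
  obtain M where M: "matching E M" "card M = m" "edge_connected k V (E - M)"
    using removable_matching_exists[OF assms(1,3,4,5) deg, of m] by blast
  \<comment> \<open>For the additional edge, \<open>m < k\<close> makes room for two free vertices.\<close>
  have "\<exists>N. matching E N \<and> card N = m + 1 \<and> edge_connected k V (E - N)"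
    if km: "k \<ge> 2" "m \<le> k - 1"
  proof -
    interpret removable_matching V E M k "k + m"
      using assms(1,2,3) deg M km by unfold_locales auto
    obtain v where v: "v \<in> V" using V_nonempty by blast
    have "k + m < card V"
      using deg[OF v] degree_less_card[OF simple v] by simp
    then have "2 * card M + 2 \<le> card V"
      using km M(2) by simp
    then show ?thesis using extend_matching M(2) by simp
  qed
  then show ?thesis using M by blast
qed

end
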